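(* Let $n\in\mathbb{N}$ and let $(\mu_k(t),\nu_k(t))$ be Sonine pairs of kernels from $L_1$ for all $k=1,\dots,n$. Then the pair of kernels $$M_n(t) = (\mu_1 * \ldots * \mu_n)(t), \quad N_n(t) = (\nu_1 * \ldots * \nu_n)(t)$$ belongs to the Luchko set $L_n$.
   Context: $C_{-1}(0,\infty)$ is the space of functions $f$ on $(0,\infty)$ that can be represented as $f(t)=t^p g(t)$ for $t>0$ with some $p>-1$ and $g\in C[0,\infty)$. $C_{-1,0}(0,\infty)$ is the space of functions $f$ on $(0,\infty)$ that can be represented as $f(t)=t^p g(t)$ for $t>0$ with some $-1<p<0$ and $g\in C[0,\infty)$. The symbol $*$ denotes the Laplace convolution $(f*g)(t)=\int_0^t f(t-\tau)g(\tau)\,d\tau$, $t>0$. $\{1\}$ is the function identically equal to $1$, and for $n\in\mathbb{N}$, $\{1\}^n$ is its $n$-fold convolution power, $\{1\}^n=h_n(t)=\frac{t^{n-1}}{(n-1)!}$. For $n\in\mathbb{N}$, the Luchko set $L_n$ is the set of pairs $(M(t),N(t))$ with $M,N\in C_{-1}(0,\infty)$ such that $(M*N)(t)=\{1\}^n$ for all $t\in(0,\infty)$. A Sonine pair is a pair $(\mu(t),\nu(t))$ with $\mu,\nu\in C_{-1,0}(0,\infty)$ and $(\mu*\nu)(t)=\{1\}$ for all $t\in(0,\infty)$; since $C_{-1,0}(0,\infty)\subset C_{-1}(0,\infty)$, Sonine pairs belong to $L_1$. *)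

theory Defs
  imports "HOL-Analysis.Analysis"
begin

text \<open>
  A function on the open half-line is represented by a total function of type
  \<open>real \<Rightarrow> real\<close>; its values at nonpositive arguments are arbitrary and are never used by
  any of the notions below.
\<close>

definition C_m1 :: "(real \<Rightarrow> real) set" where
  "C_m1 = {f. \<exists>p g. p > -1 \<and> continuous_on {0..} g \<and> (\<forall>t>0. f t = t powr p * g t)}"

definition C_m1_0 :: "(real \<Rightarrow> real) set" where
  "C_m1_0 = {f. \<exists>p g. -1 < p \<and> p < 0 \<and> continuous_on {0..} g \<and> (\<forall>t>0. f t = t powr p * g t)}"

text \<open>
  The integral is a Lebesgue integral over the open interval, so that the possible
  singularities at the end points play no role. Only positive arguments of
  \<open>f\<close> and \<open>g\<close> occur, and the integral converges absolutely for \<open>f\<close>, \<open>g\<close> in \<open>C_m1\<close>.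
\<close>

definition laplace_conv :: "(real \<Rightarrow> real) \<Rightarrow> (real \<Rightarrow> real) \<Rightarrow> real \<Rightarrow> real" where
  "laplace_conv f g t = (LINT \<tau>:{0<..<t}|lborel. f (t - \<tau>) * g \<tau>)"

text \<open>
  \<open>conv_prod f n\<close> is the product \<open>f 1 * \<dots> * f n\<close>, bracketed to the left; it is
  only meaningful for \<open>n \<ge> 1\<close>, since the convolution has no unit among functions.
\<close>

definition conv_prod :: "(nat \<Rightarrow> real \<Rightarrow> real) \<Rightarrow> nat \<Rightarrow> real \<Rightarrow> real" where
  "conv_prod f n = foldl laplace_conv (f 1) (map f [2..<Suc n])"

definition conv_power :: "(real \<Rightarrow> real) \<Rightarrow> nat \<Rightarrow> real \<Rightarrow> real" where
  "conv_power f n = conv_prod (\<lambda>_. f) n"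

definition one_fun :: "real \<Rightarrow> real" where
  "one_fun = (\<lambda>_. 1)"

definition luchko_set :: "nat \<Rightarrow> ((real \<Rightarrow> real) \<times> (real \<Rightarrow> real)) set" where
  "luchko_set n = {(M, N). M \<in> C_m1 \<and> N \<in> C_m1 \<and>
     (\<forall>t>0. laplace_conv M N t = conv_power one_fun n t)}"

definition sonine_pairs :: "((real \<Rightarrow> real) \<times> (real \<Rightarrow> real)) set" where
  "sonine_pairs = {(\<mu>, \<nu>). \<mu> \<in> C_m1_0 \<and> \<nu> \<in> C_m1_0 \<and>
     (\<forall>t>0. laplace_conv \<mu> \<nu> t = one_fun t)}"

lemma conv_prod_1: "conv_prod f 1 = f 1"
  by (simp add: conv_prod_def)

lemma conv_prod_Suc:
  "n \<ge> 1 \<Longrightarrow> conv_prod f (Suc n) = laplace_conv (conv_prod f n) (f (Suc n))"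
  by (simp add: conv_prod_def)

lemma C_m1_0_subset: "C_m1_0 \<subseteq> C_m1"
  unfolding C_m1_def C_m1_0_def by blast

lemma sonine_pairs_subset_luchko_set: "sonine_pairs \<subseteq> luchko_set 1"
  using C_m1_0_subset
  by (auto simp: sonine_pairs_def luchko_set_def conv_power_def conv_prod_def)

lemma conv_power_one_fun:
  assumes "n \<ge> 1" and "t > 0"
  shows "conv_power one_fun n t = t ^ (n - 1) / fact (n - 1)"
  using assms
proof (induction n arbitrary: t rule: dec_induct)
  case base
  then show ?case by (simp add: conv_power_def conv_prod_def one_fun_def)
next
  case (step n)
  let ?f = "\<lambda>\<tau>. (t - \<tau>) ^ (n - 1) / fact (n - 1)"
  let ?F = "\<lambda>\<tau>. - ((t - \<tau>) ^ n / fact n)"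
  have n: "fact n = real n * fact (n - 1)"
    using step.hyps by (simp add: fact_reduce)
  have "conv_power one_fun (Suc n) t
      = (LINT \<tau>:{0<..<t}|lborel. conv_power one_fun n (t - \<tau>))"
    using step.hyps by (simp add: conv_power_def conv_prod_Suc laplace_conv_def one_fun_def)
  also have "\<dots> = (LINT \<tau>:{0<..<t}|lborel. ?f \<tau>)"
    by (intro set_lebesgue_integral_cong) (auto simp: step.IH)
  also have "\<dots> = (LBINT \<tau>=0..t. ?f \<tau>)"
    using step.prems by (simp add: interval_lebesgue_integral_def zero_ereal_def)
  also have "\<dots> = ?F t - ?F 0"
    unfolding zero_ereal_def
  proof (rule interval_integral_FTC_finite)
    show "continuous_on {min 0 t..max 0 t} ?f" by (intro continuous_intros) auto
    fix x
    have "(?F has_real_derivative ?f x) (at x within {min 0 t..max 0 t})"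
      using step.hyps n by (auto intro!: derivative_eq_intros simp: field_simps)
    then show "(?F has_vector_derivative ?f x) (at x within {min 0 t..max 0 t})"
      by (simp add: has_real_derivative_iff_has_vector_derivative)
  qed
  also have "\<dots> = t ^ (Suc n - 1) / fact (Suc n - 1)"
    using step.hyps by simp
  finally show ?case .
qed

end

theory Submission
  imports Defs
begin

text \<open>
  Laplace convolution makes \<open>C_m1\<close> a commutative semigroup, and in such a semigroup
  \<open>(\<mu>\<^sub>1 * \<dots> * \<mu>\<^sub>n) * (\<nu>\<^sub>1 * \<dots> * \<nu>\<^sub>n)\<close> can be regrouped into the product of the
  \<open>\<mu>\<^sub>k * \<nu>\<^sub>k = {1}\<close>, which is \<open>{1}\<^sup>n\<close>. Adjoining one Sonine pair at a time
  (\<open>luchko_set_conv_sonine_pair\<close>), the regrouping is the interchange law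
  \<open>(M * f) * (N * g) = (M * N) * (f * g)\<close>. The analysis lies in the semigroup laws.

  Closure (\<open>laplace_conv_C_m1\<close>): if \<open>f t = t\<^sup>p a(t)\<close> and \<open>g t = t\<^sup>q b(t)\<close>, the substitution
  \<open>\<tau> = t s\<close> gives
  \<open>(f * g)(t) = t\<^bsup>p+q+1\<^esup> \<integral>\<^sub>0\<^sup>1 s\<^sup>q (1 - s)\<^sup>p a(t (1 - s)) b(t s) ds\<close>.
  As \<open>p, q > -1\<close>, the Beta weight \<open>s\<^sup>q (1 - s)\<^sup>p\<close> is integrable and \<open>p + q + 1 > -1\<close>; the
  remaining factor is continuous in \<open>t\<close> up to \<open>t = 0\<close> by dominated convergence.

  Associativity (\<open>laplace_conv_assoc\<close>) is Fubini's theorem. Its hypothesis, absolute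
  integrability of the integrand in the plane, is an instance of closure: the iterated integral
  of the modulus is \<open>((|f| * |g|) * |h|)(t)\<close>, which converges because \<open>|f|\<close>, \<open>|g|\<close> and
  \<open>|h|\<close> again lie in \<open>C_m1\<close>.
\<close>

section \<open>The class of admissible kernels\<close>

text \<open>
  Cutting a function off to zero on the nonpositive half-line turns the integral over the moving
  interval \<open>(0, t)\<close> into one over the whole line, where substitution and Fubini's theorem need
  no care with the domain.
\<close>

definition causal :: "(real \<Rightarrow> real) \<Rightarrow> real \<Rightarrow> real" where
  "causal f x = (if x > 0 then f x else 0)"

lemma laplace_conv_causal:
  "laplace_conv f g t = (LBINT \<tau>. causal f (t - \<tau>) * causal g \<tau>)"
  unfolding laplace_conv_def set_lebesgue_integral_def
  by (intro Bochner_Integration.integral_cong) (auto simp: causal_def indicator_def)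

lemma laplace_conv_nonpos: "t \<le> 0 \<Longrightarrow> laplace_conv f g t = 0"
  by (simp add: laplace_conv_def set_lebesgue_integral_def)

lemma causal_laplace_conv: "causal (laplace_conv f g) = laplace_conv f g"
  by (auto simp: causal_def laplace_conv_nonpos)

text \<open>
  The semigroup laws hold as equations of total functions, whereas the identities
  \<open>\<mu> * \<nu> = {1}\<close> are only known for positive arguments; this congruence joins the two.
\<close>

lemma laplace_conv_cong:
  assumes "\<And>x. x > 0 \<Longrightarrow> f x = f' x" and "\<And>x. x > 0 \<Longrightarrow> g x = g' x"
  shows "laplace_conv f g = laplace_conv f' g'"
proof -
  have "causal f = causal f'" "causal g = causal g'"
    using assms by (auto simp: causal_def)
  then show ?thesis by (auto simp: laplace_conv_causal)
qed

text \<open>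
  The continuous factor can be taken continuous on the whole line, by extending it with the
  constant \<open>a 0\<close> to the left; this avoids domain conditions when it is composed with
  \<open>t (1 - s)\<close> and \<open>t s\<close>.
\<close>

lemma C_m1E:
  assumes "f \<in> C_m1"
  obtains p a where "p > -1" "continuous_on UNIV a" "\<And>t. t > 0 \<Longrightarrow> f t = t powr p * a t"
proof -
  from assms obtain p a where p: "p > -1" and a: "continuous_on {0..} a"
    and f: "\<And>t. t > 0 \<Longrightarrow> f t = t powr p * a t"
    unfolding C_m1_def by blast
  have "continuous_on UNIV (\<lambda>t. a (max 0 t))"
    by (rule continuous_on_compose2[OF a]) (auto intro!: continuous_intros)
  then show thesis using p f by (intro that[of p "\<lambda>t. a (max 0 t)"]) auto
qed

lemma abs_C_m1:
  assumes "f \<in> C_m1"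
  shows "(\<lambda>t. \<bar>f t\<bar>) \<in> C_m1"
proof -
  obtain p a where "p > -1" "continuous_on UNIV a" "\<And>t. t > 0 \<Longrightarrow> f t = t powr p * a t"
    using C_m1E[OF assms] by blast
  then show ?thesis
    unfolding C_m1_def
    by (auto intro!: exI[of _ p] exI[of _ "\<lambda>t. \<bar>a t\<bar>"] continuous_intros
        intro: continuous_on_subset simp: abs_mult)
qed

lemma causal_abs: "causal (\<lambda>t. \<bar>f t\<bar>) x = \<bar>causal f x\<bar>"
  by (simp add: causal_def)

lemma causal_borel_measurable:
  assumes "f \<in> C_m1"
  shows "causal f \<in> borel_measurable borel"
proof -
  obtain p a where a: "continuous_on UNIV a" and f: "\<And>t. t > 0 \<Longrightarrow> f t = t powr p * a t"
    using C_m1E[OF assms] by blast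
  have [measurable]: "a \<in> borel_measurable borel"
    using a by (rule borel_measurable_continuous_onI)
  have "causal f = (\<lambda>t. if t > 0 then t powr p * a t else 0)"
    by (auto simp: causal_def f)
  then show ?thesis by simp
qed

section \<open>Closure under convolution\<close>

text \<open>
  On compact sets of parameters \<open>h\<close> is bounded on the support of the weight, so a constant
  multiple of \<open>|W|\<close> dominates the integrands.
\<close>

lemma
  fixes W :: "real \<Rightarrow> real" and h :: "real \<Rightarrow> real \<Rightarrow> real"
  assumes W: "integrable lborel W" and supp: "\<And>s. s \<notin> {0..1} \<Longrightarrow> W s = 0"
    and h: "continuous_on UNIV (\<lambda>(t, s). h t s)"
  shows integrable_weight_times_continuous: "integrable lborel (\<lambda>s. W s * h t s)" (is ?thesis1)
    and continuous_integral_weight_times_continuous: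
      "continuous_on UNIV (\<lambda>t. LBINT s. W s * h t s)" (is ?thesis2)
proof -
  have Wm[measurable]: "W \<in> borel_measurable borel" using W by auto
  have hm[measurable]: "h t \<in> borel_measurable borel" for t
  proof -
    have "continuous_on UNIV (\<lambda>s. case (t, s) of (t, s) \<Rightarrow> h t s)"
      by (rule continuous_on_compose2[OF h]) (auto intro!: continuous_intros)
    then show ?thesis by (intro borel_measurable_continuous_onI) simp
  qed
  have bound: "\<exists>C. \<forall>t\<in>{-R..R}. \<forall>s. \<bar>W s * h t s\<bar> \<le> C * \<bar>W s\<bar>" for R
  proof -
    have "compact ((\<lambda>(t, s). h t s) ` ({-R..R} \<times> {0..1}))"
      by (intro compact_continuous_image continuous_on_subset[OF h] compact_Times) auto
    then have "bounded ((\<lambda>(t, s). h t s) ` ({-R..R} \<times> {0..1}))"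
      by (rule compact_imp_bounded)
    then obtain C where C: "\<And>y. y \<in> (\<lambda>(t, s). h t s) ` ({-R..R} \<times> {0..1}) \<Longrightarrow> norm y \<le> C"
      unfolding bounded_iff by blast
    have "\<bar>W s * h t s\<bar> \<le> C * \<bar>W s\<bar>" if t: "t \<in> {-R..R}" for t s
    proof (cases "s \<in> {0..1}")
      case True
      then have "h t s \<in> (\<lambda>(t, s). h t s) ` ({-R..R} \<times> {0..1})" using t by force
      then have "\<bar>h t s\<bar> \<le> C" using C by fastforce
      then show ?thesis by (simp add: abs_mult mult.commute[of C] mult_left_mono)
    qed (simp add: supp)
    then show ?thesis by blast
  qed
  show ?thesis1
  proof -
    obtain C where "\<And>s. \<bar>W s * h t s\<bar> \<le> C * \<bar>W s\<bar>"
      using bound[of "\<bar>t\<bar>"] by fastforce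
    then have "norm (W s * h t s) \<le> norm (C * \<bar>W s\<bar>)" for s
      by (metis abs_ge_self order_trans real_norm_def)
    moreover have "integrable lborel (\<lambda>s. C * \<bar>W s\<bar>)" using W by simp
    ultimately show ?thesis
      using Bochner_Integration.integrable_bound[of lborel "\<lambda>s. C * \<bar>W s\<bar>" "\<lambda>s. W s * h t s"]
      by simp
  qed
  show ?thesis2
  proof (clarsimp simp: continuous_on_sequentially)
    fix X :: "nat \<Rightarrow> real" and t assume X: "X \<longlonglongrightarrow> t"
    then have "Bseq X" by (intro convergent_imp_Bseq) (auto simp: convergent_def)
    then obtain R where "\<And>n. norm (X n) \<le> R" by (auto simp: Bseq_def)
    then have R: "X n \<in> {-R..R}" for n by (auto simp: abs_le_iff minus_le_iff)
    obtain C where C: "\<And>t s. t \<in> {-R..R} \<Longrightarrow> \<bar>W s * h t s\<bar> \<le> C * \<bar>W s\<bar>"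
      using bound[of R] by blast
    show "((\<lambda>t. LBINT s. W s * h t s) \<circ> X) \<longlonglongrightarrow> (LBINT s. W s * h t s)"
      unfolding o_def
    proof (rule integral_dominated_convergence[where w = "\<lambda>s. C * \<bar>W s\<bar>"])
      show "integrable lborel (\<lambda>s. C * \<bar>W s\<bar>)" using W by simp
      show "AE s in lborel. norm (W s * h (X n) s) \<le> C * \<bar>W s\<bar>" for n
        using C R by simp
      have "(\<lambda>n. h (X n) s) \<longlonglongrightarrow> h t s" for s
      proof -
        have "(\<lambda>n. (X n, s)) \<longlonglongrightarrow> (t, s)" by (intro tendsto_intros X)
        then show ?thesis
          using h continuous_on_tendsto_compose[OF h, of "\<lambda>n. (X n, s)" "(t, s)" sequentially]
          by simp
      qed
      then show "AE s in lborel. (\<lambda>n. W s * h (X n) s) \<longlonglongrightarrow> W s * h t s"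
        by (auto intro!: tendsto_intros)
    qed simp_all
  qed
qed

text \<open>
  Both claims come from rescaling \<open>(0, t)\<close> to the unit interval, which separates the factor
  \<open>t\<^bsup>p+q+1\<^esup>\<close> from a Beta-type integral that depends continuously on \<open>t\<close>.
\<close>

lemma
  assumes "f \<in> C_m1" and "g \<in> C_m1"
  shows integrable_causal_conv: "integrable lborel (\<lambda>\<tau>. causal f (t - \<tau>) * causal g \<tau>)"
    and laplace_conv_C_m1: "laplace_conv f g \<in> C_m1"
proof -
  obtain p a where p: "p > -1" and a: "continuous_on UNIV a"
    and f: "\<And>t. t > 0 \<Longrightarrow> f t = t powr p * a t" using C_m1E[OF assms(1)] by blast
  obtain q b where q: "q > -1" and b: "continuous_on UNIV b"
    and g: "\<And>t. t > 0 \<Longrightarrow> g t = t powr q * b t" using C_m1E[OF assms(2)] by blast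
  define W where "W s = indicator {0..1} s * (s powr q * (1 - s) powr p)" for s :: real
  define h where "h t s = a (t * (1 - s)) * b (t * s)" for t s
  have W: "integrable lborel W"
    using integrable_Beta[of "q + 1" "p + 1"] p q by (simp add: set_integrable_def W_def[abs_def])
  have supp: "W s = 0" if "s \<notin> {0..1}" for s using that by (simp add: W_def)
  have h: "continuous_on UNIV (\<lambda>(t, s). h t s)"
    unfolding h_def case_prod_beta
    by (intro continuous_intros continuous_on_compose2[OF a] continuous_on_compose2[OF b]) auto
  \<comment> \<open>The argument \<open>0 + t * s\<close> has the shape of the affine substitution rules for \<open>lborel\<close>.\<close>
  have scaled: "causal f (t - (0 + t * s)) * causal g (0 + t * s) = t powr (p + q) * (W s * h t s)"
    if t: "t > 0" for t s
  proof (cases "s \<in> {0<..<1}")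
    case True
    then have "t * (1 - s) > 0" "t * s > 0" using t by auto
    moreover have "t - t * s = t * (1 - s)" by (simp add: algebra_simps)
    ultimately show ?thesis
      using True t by (simp add: causal_def f g W_def h_def powr_mult powr_add)
  next
    case False
    \<comment> \<open>At the end points of the unit interval the right-hand side vanishes, whatever the
      exponents, since \<open>0 powr x = 0\<close> for all \<open>x\<close>.\<close>
    then consider "s \<le> 0" | "s \<ge> 1" by force
    then show ?thesis
    proof cases
      case 1
      then have "t * s \<le> 0" using t by (simp add: mult_le_0_iff)
      then show ?thesis using 1 by (auto simp: causal_def W_def indicator_def)
    next
      case 2
      then have "t - t * s \<le> 0" using t by simp
      then show ?thesis using 2 by (auto simp: causal_def W_def indicator_def)
    qed
  qed
  show "integrable lborel (\<lambda>\<tau>. causal f (t - \<tau>) * causal g \<tau>)"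
  proof (cases "t > 0")
    case True
    have "integrable lborel (\<lambda>s. t powr (p + q) * (W s * h t s))"
      using integrable_weight_times_continuous[OF W supp h] by simp
    then show ?thesis
      unfolding scaled[OF True, symmetric] using True
      by (subst (asm) lborel_integrable_real_affine_iff) auto
  next
    case False
    then have "(\<lambda>\<tau>. causal f (t - \<tau>) * causal g \<tau>) = (\<lambda>_. 0)" by (auto simp: causal_def)
    then show ?thesis by simp
  qed
  \<comment> \<open>The additional power of \<open>t\<close> is the Jacobian of \<open>\<tau> = t s\<close>.\<close>
  have "laplace_conv f g t = t powr (p + q + 1) * (LBINT s. W s * h t s)" if t: "t > 0" for t
  proof -
    have "laplace_conv f g t = \<bar>t\<bar> *\<^sub>R (LBINT s. causal f (t - (0 + t * s)) * causal g (0 + t * s))"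
      unfolding laplace_conv_causal
      by (rule lborel_integral_real_affine) (use t in auto)
    also have "\<dots> = t powr (p + q + 1) * (LBINT s. W s * h t s)"
      unfolding scaled[OF t] using t by (simp add: powr_add)
    finally show ?thesis .
  qed
  moreover have "continuous_on {0..} (\<lambda>t. LBINT s. W s * h t s)"
    using continuous_integral_weight_times_continuous[OF W supp h] continuous_on_subset by blast
  ultimately show "laplace_conv f g \<in> C_m1"
    unfolding C_m1_def using p q by (intro CollectI exI[of _ "p + q + 1"]) auto
qed

section \<open>The algebra of convolution\<close>

lemma laplace_conv_commute: "laplace_conv f g = laplace_conv g f"
proof
  fix t
  have "laplace_conv f g t = \<bar>-1\<bar> *\<^sub>R (LBINT \<tau>. causal f (t - (t + -1 * \<tau>)) * causal g (t + -1 * \<tau>))"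
    unfolding laplace_conv_causal by (rule lborel_integral_real_affine) auto
  also have "\<dots> = laplace_conv g f t"
    unfolding laplace_conv_causal by (simp add: mult.commute)
  finally show "laplace_conv f g t = laplace_conv g f t" .
qed

text \<open>
  Both triple convolutions are iterated integrals of one function \<open>K\<close> on the plane, taken in
  opposite orders.
\<close>

lemma laplace_conv_assoc:
  assumes f: "f \<in> C_m1" and g: "g \<in> C_m1" and h: "h \<in> C_m1"
  shows "laplace_conv (laplace_conv f g) h = laplace_conv f (laplace_conv g h)"
proof
  fix t
  note [measurable] = causal_borel_measurable[OF f] causal_borel_measurable[OF g]
    causal_borel_measurable[OF h]
  let ?K = "\<lambda>\<tau> \<sigma>. causal f (t - \<sigma>) * causal g (\<sigma> - \<tau>) * causal h \<tau>"
  have inner: "(LBINT \<sigma>. causal f' (t - \<sigma>) * causal g' (\<sigma> - \<tau>)) = laplace_conv f' g' (t - \<tau>)"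
    for f' g' \<tau>
    unfolding laplace_conv_causal
    by (subst lborel_integral_real_affine[where c = 1 and t = \<tau>]) (auto simp: algebra_simps)
  have int_inner: "integrable lborel (\<lambda>\<sigma>. causal f (t - \<sigma>) * causal g (\<sigma> - \<tau>))" for \<tau>
    by (subst lborel_integrable_real_affine_iff[where c = 1 and t = \<tau>, symmetric])
      (use integrable_causal_conv[OF f g, of "t - \<tau>"] in \<open>auto simp: algebra_simps\<close>)
  have int: "integrable (lborel \<Otimes>\<^sub>M lborel) (case_prod ?K)"
  proof (rule lborel_pair.Fubini_integrable)
    show "case_prod ?K \<in> borel_measurable (lborel \<Otimes>\<^sub>M lborel)" by measurable
    have norm_K: "norm (?K \<tau> \<sigma>)
        = causal (\<lambda>x. \<bar>f x\<bar>) (t - \<sigma>) * causal (\<lambda>x. \<bar>g x\<bar>) (\<sigma> - \<tau>) * \<bar>causal h \<tau>\<bar>" for \<tau> \<sigma>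
      by (simp add: abs_mult causal_abs)
    have "(LBINT \<sigma>. norm (case (\<tau>, \<sigma>) of (\<tau>, \<sigma>) \<Rightarrow> ?K \<tau> \<sigma>))
        = causal (laplace_conv (\<lambda>x. \<bar>f x\<bar>) (\<lambda>x. \<bar>g x\<bar>)) (t - \<tau>) * causal (\<lambda>x. \<bar>h x\<bar>) \<tau>" for \<tau>
      unfolding prod.case norm_K causal_laplace_conv by (simp add: inner causal_abs[of h])
    then show "integrable lborel (\<lambda>\<tau>. LBINT \<sigma>. norm (case (\<tau>, \<sigma>) of (\<tau>, \<sigma>) \<Rightarrow> ?K \<tau> \<sigma>))"
      using integrable_causal_conv[OF laplace_conv_C_m1[OF abs_C_m1[OF f] abs_C_m1[OF g]] abs_C_m1[OF h]]
      by simp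
    show "AE \<tau> in lborel. integrable lborel (\<lambda>\<sigma>. case (\<tau>, \<sigma>) of (\<tau>, \<sigma>) \<Rightarrow> ?K \<tau> \<sigma>)"
      using int_inner by simp
  qed
  have "laplace_conv (laplace_conv f g) h t = (LBINT \<tau>. LBINT \<sigma>. ?K \<tau> \<sigma>)"
    unfolding laplace_conv_causal[of "laplace_conv f g"] causal_laplace_conv by (simp add: inner)
  also have "\<dots> = (LBINT \<sigma>. LBINT \<tau>. ?K \<tau> \<sigma>)"
    using lborel_pair.Fubini_integral[OF int] by simp
  also have "\<dots> = laplace_conv f (laplace_conv g h) t"
    unfolding laplace_conv_causal[of f] causal_laplace_conv
    unfolding laplace_conv_causal[of g] by (simp add: mult.assoc)
  finally show "laplace_conv (laplace_conv f g) h t = laplace_conv f (laplace_conv g h) t" .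
qed

lemma laplace_conv_interchange:
  assumes M: "M \<in> C_m1" and N: "N \<in> C_m1" and f: "f \<in> C_m1" and g: "g \<in> C_m1"
  shows "laplace_conv (laplace_conv M f) (laplace_conv N g)
    = laplace_conv (laplace_conv M N) (laplace_conv f g)"
proof -
  have "laplace_conv (laplace_conv M f) (laplace_conv N g)
      = laplace_conv M (laplace_conv (laplace_conv f N) g)"
    using assms by (simp add: laplace_conv_assoc laplace_conv_C_m1)
  also have "\<dots> = laplace_conv M (laplace_conv (laplace_conv N f) g)"
    by (simp add: laplace_conv_commute[of f N])
  also have "\<dots> = laplace_conv (laplace_conv M N) (laplace_conv f g)"
    using assms by (simp add: laplace_conv_assoc laplace_conv_C_m1)
  finally show ?thesis .
qed

section \<open>Products of Sonine pairs\<close>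

lemma luchko_set_conv_sonine_pair:
  assumes n: "n \<ge> 1" and MN: "(M, N) \<in> luchko_set n" and fg: "(f, g) \<in> sonine_pairs"
  shows "(laplace_conv M f, laplace_conv N g) \<in> luchko_set (Suc n)"
proof -
  have M: "M \<in> C_m1" and N: "N \<in> C_m1"
    and conv_MN: "\<And>t. t > 0 \<Longrightarrow> laplace_conv M N t = conv_power one_fun n t"
    using MN by (auto simp: luchko_set_def)
  have f: "f \<in> C_m1" and g: "g \<in> C_m1"
    and conv_fg: "\<And>t. t > 0 \<Longrightarrow> laplace_conv f g t = one_fun t"
    using fg C_m1_0_subset by (auto simp: sonine_pairs_def)
  have "laplace_conv (laplace_conv M f) (laplace_conv N g)
      = laplace_conv (laplace_conv M N) (laplace_conv f g)"
    by (rule laplace_conv_interchange[OF M N f g])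
  also have "\<dots> = laplace_conv (conv_power one_fun n) one_fun"
    by (rule laplace_conv_cong) (simp_all add: conv_MN conv_fg)
  also have "\<dots> = conv_power one_fun (Suc n)"
    using n by (simp add: conv_power_def conv_prod_Suc)
  finally show ?thesis
    using M N f g by (simp add: luchko_set_def laplace_conv_C_m1)
qed

theorem theorem1:
  fixes n :: nat and \<mu> \<nu> :: "nat \<Rightarrow> real \<Rightarrow> real"
  assumes "n \<ge> 1"
    and "\<And>k. k \<in> {1..n} \<Longrightarrow> (\<mu> k, \<nu> k) \<in> sonine_pairs"
  shows "(conv_prod \<mu> n, conv_prod \<nu> n) \<in> luchko_set n"
  using assms
proof (induction n rule: dec_induct)
  case base
  then show ?case
    using sonine_pairs_subset_luchko_set by (auto simp: conv_prod_def)
next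
  case (step n)
  then show ?case
    by (simp add: conv_prod_Suc luchko_set_conv_sonine_pair)
qed

end
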